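(* For every integer $m$, \[ \sum_{n=1}^\infty (-1)^n\Big\lfloor\frac{n}{2}\Big\rfloor\frac{F_{n+m}}{2^n n}=\frac{F_m}{8}\log 5+\frac{3}{4\sqrt5}L_m\log\alpha-\frac{L_m}{10} \] and \[ \sum_{n=1}^\infty (-1)^n\Big\lfloor\frac{n}{2}\Big\rfloor\frac{L_{n+m}}{2^n n}=\frac{L_m}{8}\log 5+\frac{3\sqrt5}{4}F_m\log\alpha-\frac{F_m}{2}. \]
   Context: $F_n$ and $L_n$ are the Fibonacci and Lucas numbers ($F_0=0,F_1=1$, $L_0=2,L_1=1$, both satisfying $X_n=X_{n-1}+X_{n-2}$, extended to negative indices by $F_{-n}=(-1)^{n-1}F_n$, $L_{-n}=(-1)^nL_n$); $\alpha=(1+\sqrt5)/2$. $\lfloor x\rfloor$ is the floor function and $\log$ the natural logarithm. *)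

theory Defs
  imports "HOL-Analysis.Analysis" "HOL-Number_Theory.Fib"
begin

fun lucas_nat :: "nat \<Rightarrow> nat" where
  "lucas_nat 0 = 2"
| "lucas_nat (Suc 0) = 1"
| "lucas_nat (Suc (Suc n)) = lucas_nat (Suc n) + lucas_nat n"

(* For k = -n < 0 the exponents below are n - 1 and n; n >= 1, so the subtraction on nat
   does not truncate. *)

definition fib_int :: "int \<Rightarrow> int" where
  "fib_int k = (if k \<ge> 0 then int (fib (nat k))
                else (-1) ^ (nat (- k) - 1) * int (fib (nat (- k))))"

definition lucas_int :: "int \<Rightarrow> int" where
  "lucas_int k = (if k \<ge> 0 then int (lucas_nat (nat k))
                  else (-1) ^ nat (- k) * int (lucas_nat (nat (- k))))"

definition golden_ratio :: real where
  "golden_ratio = (1 + sqrt 5) / 2"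

end

theory Submission
  imports Defs
begin

text \<open>
  Since \<open>\<lfloor>n/2\<rfloor> = n/2 - 1/4 + (-1)^n/4\<close>, the series \<open>G(x) = \<Sum> (-1)^n \<lfloor>n/2\<rfloor> x^n / n\<close> splits into
  a geometric and two logarithmic series. Its values at \<open>\<alpha>/2\<close> and \<open>\<beta>/2\<close>, where \<open>\<beta> = 1 - \<alpha>\<close>, are
  explicit because \<open>(1+x)/(1-x)\<close> equals \<open>\<surd>5 \<alpha>^3\<close> and \<open>\<surd>5 \<alpha>^(-3)\<close> there. Binet's formulas express
  both sums as linear combinations of these two values.
\<close>

abbreviation golden_conj :: real where
  "golden_conj \<equiv> 1 - golden_ratio"

lemma golden_ratio_square: "golden_ratio ^ 2 = golden_ratio + 1"
  by (simp add: golden_ratio_def power2_eq_square field_simps)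

lemma golden_ratio_gt_1: "golden_ratio > 1"
proof -
  have "sqrt 5 > 1" by (simp add: real_less_rsqrt)
  then show ?thesis by (simp add: golden_ratio_def)
qed

text \<open>Puts \<alpha>/2 inside the interval of convergence of the series G and keeps 1 -
  \<alpha>/2 positive.\<close>

lemma golden_ratio_less_2: "golden_ratio < 2"
proof -
  have "sqrt 5 < 3" by (simp add: real_less_lsqrt)
  then show ?thesis by (simp add: golden_ratio_def)
qed

lemma sqrt5_eq_golden_ratio: "sqrt 5 = 2 * golden_ratio - 1"
  by (simp add: golden_ratio_def field_simps)

lemma fib_binet: "real (fib n) = (golden_ratio ^ n - golden_conj ^ n) / sqrt 5"
proof -
  have conj: "golden_conj = (1 - sqrt 5) / 2"
    by (simp add: golden_ratio_def field_simps)
  show ?thesis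
    using fib_closed_form[of n] unfolding conj by (simp only: golden_ratio_def)
qed

text \<open>Both bases are roots of x^2 = x + 1, so their powers satisfy the recurrence of
  \<open>lucas_nat\<close>; the initial values are 1 + 1 and the sum of the roots.\<close>

lemma lucas_nat_binet: "real (lucas_nat n) = golden_ratio ^ n + golden_conj ^ n"
proof (induction n rule: lucas_nat.induct)
  case (3 n)
  have "golden_conj ^ 2 = golden_conj + 1"
    using golden_ratio_square by (simp add: power2_eq_square algebra_simps)
  then have "golden_ratio ^ n * golden_ratio ^ 2 + golden_conj ^ n * golden_conj ^ 2
      = golden_ratio ^ n * (golden_ratio + 1) + golden_conj ^ n * (golden_conj + 1)"
    using golden_ratio_square by simp
  then show ?case
    using 3 by (simp add: power2_eq_square algebra_simps)
qed simp_all

text \<open>The product of the two roots is -1.\<close>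

lemma inverse_golden_ratio: "inverse golden_ratio = - golden_conj"
  using golden_ratio_square golden_ratio_gt_1 by (simp add: field_simps power2_eq_square)

lemma inverse_golden_conj: "inverse golden_conj = - golden_ratio"
  using golden_ratio_square golden_ratio_gt_1 by (simp add: field_simps power2_eq_square)

lemma golden_ratio_powi_minus: "golden_ratio powi (- int n) = (-1) ^ n * golden_conj ^ n"
  unfolding power_int_minus power_int_of_nat power_inverse[symmetric] inverse_golden_ratio
  by (rule power_minus)

lemma golden_conj_powi_minus: "golden_conj powi (- int n) = (-1) ^ n * golden_ratio ^ n"
  unfolding power_int_minus power_int_of_nat power_inverse[symmetric] inverse_golden_conj
  by (rule power_minus)

text \<open>For negative indices, inversion exchanges the two roots up to sign. The exchange negates
  the difference of the powers, which is why the sign exponent in \<open>fib_int\<close> is one less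
  than in \<open>lucas_int\<close>, where the sum is symmetric.\<close>

lemma fib_int_binet:
  "of_int (fib_int k) = (golden_ratio powi k - golden_conj powi k) / sqrt 5"
proof (cases "k \<ge> 0")
  case True
  then show ?thesis
    by (simp add: fib_int_def fib_binet power_int_def)
next
  case False
  then obtain n where k: "k = - int (Suc n)"
    by (metis negD not_le)
  then have "of_int (fib_int k) = (-1) ^ n * real (fib (Suc n))"
    by (simp add: fib_int_def nat_add_distrib del: fib.simps)
  then show ?thesis
    unfolding k golden_ratio_powi_minus golden_conj_powi_minus fib_binet
    by (simp only: power_Suc) (simp add: algebra_simps)
qed

lemma lucas_int_binet:
  "of_int (lucas_int k) = golden_ratio powi k + golden_conj powi k"
proof (cases "k \<ge> 0")
  case True
  then show ?thesis
    by (simp add: lucas_int_def lucas_nat_binet power_int_def)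
next
  case False
  then obtain n where k: "k = - int (Suc n)"
    by (metis negD not_le)
  then have "of_int (lucas_int k) = (-1) ^ Suc n * real (lucas_nat (Suc n))"
    by (simp add: lucas_int_def nat_add_distrib del: lucas_nat.simps)
  then show ?thesis
    unfolding k golden_ratio_powi_minus golden_conj_powi_minus lucas_nat_binet
    by (simp only: distrib_left add.commute)
qed

text \<open>The last two terms cancel for even n and add up to -1/2 for odd n.\<close>

lemma floor_half_eq:
  "of_int \<lfloor>real n / 2\<rfloor> = real n / 2 - 1 / 4 + (-1) ^ n / (4 :: real)"
proof -
  have "\<lfloor>real n / 2\<rfloor> = int (n div 2)"
    using floor_divide_of_nat_eq[of n 2] by simp
  then show ?thesis
    by (cases "even n") (auto elim!: evenE oddE simp: field_simps)
qed

text \<open>Multiplying \<open>floor_half_eq\<close> by (-x)^n / n gives (-x)^n / 2 - (-x)^n / (4n)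
  + x^n / (4n): a geometric series and the series of ln (1 + x) / 4 and of -ln (1 - x) / 4.\<close>

lemma sums_floor_half:
  fixes x :: real
  assumes "\<bar>x\<bar> < 1"
  shows "(\<lambda>k. (-1) ^ Suc k * of_int \<lfloor>real (Suc k) / 2\<rfloor> * (x ^ Suc k / real (Suc k)))
    sums (ln ((1 + x) / (1 - x)) / 4 - x / (2 * (1 + x)))"
proof -
  have pos: "1 + x > 0" "1 - x > 0"
    using assms by auto
  have "(\<lambda>k. - x * (- x) ^ k) sums (- x * (1 / (1 - (- x))))"
    using assms by (intro sums_mult geometric_sums) simp
  then have geom: "(\<lambda>k. (- x) ^ Suc k) sums (- x / (1 + x))"
    by simp
  \<comment> \<open>The term of \<open>ln_series'\<close> at index 0 is a division by zero, hence 0,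
    so starting at index 1 leaves the sum unchanged.\<close>
  have log: "(\<lambda>k. - ((- y) ^ Suc k) / real (Suc k)) sums ln (1 + y)" if "\<bar>y\<bar> < 1" for y :: real
    using ln_series'[OF that] by (subst sums_Suc_iff) simp
  have "(\<lambda>k. (- x) ^ Suc k / 2 + (- ((- x) ^ Suc k) / real (Suc k)) / 4
        - (- ((- (- x)) ^ Suc k) / real (Suc k)) / 4)
      sums (- x / (1 + x) / 2 + ln (1 + x) / 4 - ln (1 + - x) / 4)"
    using assms by (intro sums_add sums_diff sums_divide geom log) auto
  also have "- x / (1 + x) / 2 + ln (1 + x) / 4 - ln (1 + - x) / 4
      = ln ((1 + x) / (1 - x)) / 4 - x / (2 * (1 + x))"
    using pos by (simp add: ln_div diff_divide_distrib mult.commute)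
  also have "(\<lambda>k. (- x) ^ Suc k / 2 + (- ((- x) ^ Suc k) / real (Suc k)) / 4
        - (- ((- (- x)) ^ Suc k) / real (Suc k)) / 4)
      = (\<lambda>k. (-1) ^ Suc k * of_int \<lfloor>real (Suc k) / 2\<rfloor> * (x ^ Suc k / real (Suc k)))"
  proof
    fix k
    \<comment> \<open>Here s = (-1)^n, p = x^n and r = n; the square of the sign turns the
      alternating part of the floor into the series without signs.\<close>
    have split: "s * p / 2 + (- (s * p) / r) / 4 - (- p / r) / 4 = s * (r / 2 - 1 / 4 + s / 4) * (p / r)"
      if "s * s = 1" "r \<noteq> 0" for r s p :: real
    proof -
      have "s * (r / 2 - 1 / 4 + s / 4) * (p / r) = s * p / 2 - s * p / r / 4 + (s * s) * p / r / 4"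
        using that(2) by (simp add: field_simps)
      then show ?thesis using that(1) by simp
    qed
    have "(-1 :: real) ^ Suc k * (-1) ^ Suc k = 1"
      by (simp flip: power_mult_distrib)
    then show "(- x) ^ Suc k / 2 + (- ((- x) ^ Suc k) / real (Suc k)) / 4
        - (- ((- (- x)) ^ Suc k) / real (Suc k)) / 4
      = (-1) ^ Suc k * of_int \<lfloor>real (Suc k) / 2\<rfloor> * (x ^ Suc k / real (Suc k))"
      unfolding floor_half_eq power_minus[of x] minus_minus by (rule split) simp
  qed
  finally show ?thesis .
qed

text \<open>Both evaluations at x = \<alpha>/2 follow from 2 + \<alpha> = sqrt 5 * \<alpha> and 2 -
  \<alpha> = 1 / \<alpha>^2.\<close>

lemma sums_floor_half_golden_ratio:
  "(\<lambda>k. (-1) ^ Suc k * of_int \<lfloor>real (Suc k) / 2\<rfloor> * ((golden_ratio / 2) ^ Suc k / real (Suc k)))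
    sums (ln 5 / 8 + 3 / 4 * ln golden_ratio - 1 / (2 * sqrt 5))"
proof -
  have pos: "golden_ratio > 0" "2 - golden_ratio > 0"
    using golden_ratio_gt_1 golden_ratio_less_2 by auto
  have "(1 + golden_ratio / 2) / (1 - golden_ratio / 2) = sqrt 5 * golden_ratio ^ 3"
    using pos golden_ratio_square by (simp add: sqrt5_eq_golden_ratio divide_simps) algebra
  then have "ln ((1 + golden_ratio / 2) / (1 - golden_ratio / 2)) = ln 5 / 2 + 3 * ln golden_ratio"
    using pos by (simp add: ln_mult ln_realpow ln_sqrt)
  moreover have "golden_ratio / 2 / (2 * (1 + golden_ratio / 2)) = 1 / (2 * sqrt 5)"
    using golden_ratio_gt_1 golden_ratio_square
    by (simp add: sqrt5_eq_golden_ratio divide_simps) algebra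
  ultimately show ?thesis
    using sums_floor_half[of "golden_ratio / 2"] pos
    by (simp add: add_divide_distrib diff_divide_distrib)
qed

text \<open>The conjugate identities are 2 + \<beta> = -sqrt 5 * \<beta> = sqrt 5 / \<alpha> and 2 -
  \<beta> = \<alpha>^2.\<close>

lemma sums_floor_half_golden_conj:
  "(\<lambda>k. (-1) ^ Suc k * of_int \<lfloor>real (Suc k) / 2\<rfloor> * ((golden_conj / 2) ^ Suc k / real (Suc k)))
    sums (ln 5 / 8 - 3 / 4 * ln golden_ratio + 1 / (2 * sqrt 5))"
proof -
  have pos: "golden_ratio > 0" "golden_ratio > 1" "3 - golden_ratio > 0"
    using golden_ratio_gt_1 golden_ratio_less_2 by auto
  have "(1 + golden_conj / 2) / (1 - golden_conj / 2) = sqrt 5 / golden_ratio ^ 3"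
    using pos golden_ratio_square by (simp add: sqrt5_eq_golden_ratio divide_simps) algebra
  then have "ln ((1 + golden_conj / 2) / (1 - golden_conj / 2)) = ln 5 / 2 - 3 * ln golden_ratio"
    using pos by (simp add: ln_div ln_realpow ln_sqrt)
  moreover have "golden_conj / 2 / (2 * (1 + golden_conj / 2)) = - (1 / (2 * sqrt 5))"
    using pos golden_ratio_square
    by (simp add: sqrt5_eq_golden_ratio divide_simps) algebra
  ultimately show ?thesis
    using sums_floor_half[of "golden_conj / 2"] pos
    by (simp add: add_divide_distrib diff_divide_distrib)
qed

theorem theorem4:
  fixes m :: int
  shows "((\<lambda>k. let n = Suc k in
             (-1) ^ n * of_int \<lfloor>real n / 2\<rfloor> * (of_int (fib_int (int n + m)) / (2 ^ n * real n))) sums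
           (of_int (fib_int m) / 8 * ln 5
            + 3 / (4 * sqrt 5) * of_int (lucas_int m) * ln golden_ratio
            - of_int (lucas_int m) / (10 :: real))) \<and>
         ((\<lambda>k. let n = Suc k in
             (-1) ^ n * of_int \<lfloor>real n / 2\<rfloor> * (of_int (lucas_int (int n + m)) / (2 ^ n * real n))) sums
           (of_int (lucas_int m) / 8 * ln 5
            + 3 * sqrt 5 / 4 * of_int (fib_int m) * ln golden_ratio
            - of_int (fib_int m) / (2 :: real)))"
proof -
  define c where "c k = (-1) ^ Suc k * of_int \<lfloor>real (Suc k) / 2\<rfloor> / (2 ^ Suc k * real (Suc k))"
    for k :: nat
  define A where "A = ln 5 / 8 + 3 / 4 * ln golden_ratio - 1 / (2 * sqrt 5)"
  define B where "B = ln 5 / 8 - 3 / 4 * ln golden_ratio + 1 / (2 * sqrt 5)"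
  define a where "a = golden_ratio powi m"
  define b where "b = golden_conj powi m"
  have A: "(\<lambda>k. c k * golden_ratio ^ Suc k) sums A"
    using sums_floor_half_golden_ratio unfolding A_def c_def
    by (simp only: power_divide divide_divide_eq_left times_divide_eq_left times_divide_eq_right)
  have B: "(\<lambda>k. c k * golden_conj ^ Suc k) sums B"
    using sums_floor_half_golden_conj unfolding B_def c_def
    by (simp only: power_divide divide_divide_eq_left times_divide_eq_left times_divide_eq_right)
  have powi_shift: "x powi (int n + m) = x ^ n * x powi m" if "x \<noteq> 0" for x :: real and n
    using that by (simp add: power_int_add)
  have nz: "golden_ratio \<noteq> 0" "golden_conj \<noteq> 0"
    using golden_ratio_gt_1 by auto
  \<comment> \<open>The shift by m only contributes the factors \<open>a\<close> and
    \<open>b\<close>, which do not depend on n, so \<open>A\<close> and \<open>B\<close> determine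
    both sums.\<close>
  have F: "of_int (fib_int (int n + m)) = (golden_ratio ^ n * a - golden_conj ^ n * b) / sqrt 5"
    and L: "of_int (lucas_int (int n + m)) = golden_ratio ^ n * a + golden_conj ^ n * b" for n
    by (simp_all only: fib_int_binet lucas_int_binet powi_shift[OF nz(1)] powi_shift[OF nz(2)]
        a_def b_def)
  have Fm: "of_int (fib_int m) = (a - b) / sqrt 5" and Lm: "of_int (lucas_int m) = a + b"
    by (simp_all only: fib_int_binet lucas_int_binet a_def b_def)
  have sqrt5: "sqrt 5 * (sqrt 5 * x) = 5 * x" for x
    by (simp flip: mult.assoc)
  have "(\<lambda>k. (c k * golden_ratio ^ Suc k * a - c k * golden_conj ^ Suc k * b) / sqrt 5)
      sums ((A * a - B * b) / sqrt 5)"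
    by (intro sums_divide sums_diff sums_mult2 A B)
  \<comment> \<open>With D = 3/4 * ln \<alpha> - 1 / (2 * sqrt 5), \<open>A\<close> and
    \<open>B\<close> are ln 5 / 8 + D and ln 5 / 8 - D. Hence the coefficient of F_m is ln 5 / 8 and
    that of L_m is D / sqrt 5, whose constant part is -1/10.\<close>
  moreover have "(A * a - B * b) / sqrt 5 = of_int (fib_int m) / 8 * ln 5
      + 3 / (4 * sqrt 5) * of_int (lucas_int m) * ln golden_ratio
      - of_int (lucas_int m) / (10 :: real)"
    unfolding Fm Lm A_def B_def by (simp add: field_simps sqrt5)
  moreover have "(\<lambda>k. c k * golden_ratio ^ Suc k * a + c k * golden_conj ^ Suc k * b)
      sums (A * a + B * b)"
    by (intro sums_add sums_mult2 A B)
  \<comment> \<open>Now ln 5 / 8 multiplies a + b = L_m, and D multiplies a - b = sqrt 5 *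
    F_m.\<close>
  moreover have "A * a + B * b = of_int (lucas_int m) / 8 * ln 5
      + 3 * sqrt 5 / 4 * of_int (fib_int m) * ln golden_ratio
      - of_int (fib_int m) / (2 :: real)"
    unfolding Fm Lm A_def B_def by (simp add: field_simps sqrt5)
  ultimately show ?thesis
    unfolding Let_def F L c_def
    by (simp only: times_divide_eq_left times_divide_eq_right divide_divide_eq_left
        add_divide_distrib diff_divide_distrib distrib_left right_diff_distrib ac_simps)
qed

end
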